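(* Let $r\in\{0,1,\dots,n\}$ and let $\{u_k\}_{k=0}^{N-1}$ be an input sequence with $u_k\in\mathbb{R}^m$. If $\{u_k\}_{k=0}^{N-r-1}$ is persistently exciting of order $n+1-r$, then, for any output reachable system $\Sigma\in\bm{\Sigma}_{n,m,p}^{\mathrm{or}}$ whose Markov parameters satisfy $$\Gamma_i=0\ \text{ for } i=0,\dots,r-1,\quad\text{and}\quad \Gamma_r\neq0,$$ and any $x_0\in\mathbb{R}^n$, the output sequence $\{y_k(\Sigma,x_0,u)\}_{k=0}^{N-1}$ is persistently exciting of order $1$.
   Context: All matrices are real. System: $\Sigma=(A,B,C,D)$ with $A\in\mathbb{R}^{n\times n}$, $B\in\mathbb{R}^{n\times m}$, $C\in\mathbb{R}^{p\times n}$, $D\in\mathbb{R}^{p\times m}$ denotes the discrete-time linear time-invariant system $x_{k+1}=Ax_k+Bu_k$, $y_k=Cx_k+Du_k$. $\{y_k(\Sigma,x_0,u)\}_{k=0}^{N-1}$ denotes the output sequence generated by applying $\{u_k\}_{k=0}^{N-1}$ to $\Sigma$ with initial condition $x_0$. Markov parameters: $\Gamma_0=D$, $\Gamma_i=CA^{i-1}B$ for $i=1,\dots,n$. Output reachability: $\Sigma$ is output reachable if for any $\hat y\in\mathbb{R}^p$ there exist an integer $T\geq0$ and an input sequence $\{u_k\}_{k=0}^T$ such that $y_T(\Sigma,0,u)=\hat y$. $\bm{\Sigma}_{n,m,p}^{\mathrm{or}}$ denotes the set of all output reachable systems $(A,B,C,D)$ with $A\in\mathbb{R}^{n\times n}$,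 $B\in\mathbb{R}^{n\times m}$, $C\in\mathbb{R}^{p\times n}$, $D\in\mathbb{R}^{p\times m}$. Persistence of excitation: for a sequence $\{w_k\}_{k=0}^{N'-1}$ with $w_k\in\mathbb{R}^q$, $H_L(w)\in\mathbb{R}^{qL\times(N'-L+1)}$ is the block Hankel matrix whose columns are $\begin{bmatrix}w_k^\top&\dots&w_{k+L-1}^\top\end{bmatrix}^\top$, $k=0,\dots,N'-L$. The sequence is persistently exciting (PE) of order $L$ if $\mathrm{rank}(H_L(w))=qL$. *)

theory Defs
  imports Complex_Main "Jordan_Normal_Form.DL_Rank"
begin

text \<open>A finite sequence w_0, ..., w_{N-1} is a function on nat together with its length N; values at
  indices from N on are irrelevant.\<close>

type_synonym lti = "real mat \<times> real mat \<times> real mat \<times> real mat"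

definition lti_systems :: "nat \<Rightarrow> nat \<Rightarrow> nat \<Rightarrow> lti set" where
  "lti_systems n m p =
     carrier_mat n n \<times> carrier_mat n m \<times> carrier_mat p n \<times> carrier_mat p m"

fun state :: "lti \<Rightarrow> real vec \<Rightarrow> (nat \<Rightarrow> real vec) \<Rightarrow> nat \<Rightarrow> real vec" where
  "state (A, B, C, D) x0 u 0 = x0"
| "state (A, B, C, D) x0 u (Suc k) = A *\<^sub>v state (A, B, C, D) x0 u k + B *\<^sub>v u k"

fun lti_output :: "lti \<Rightarrow> real vec \<Rightarrow> (nat \<Rightarrow> real vec) \<Rightarrow> nat \<Rightarrow> real vec" where
  "lti_output (A, B, C, D) x0 u k = C *\<^sub>v state (A, B, C, D) x0 u k + D *\<^sub>v u k"

fun markov :: "lti \<Rightarrow> nat \<Rightarrow> real mat" where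
  "markov (A, B, C, D) 0 = D"
| "markov (A, B, C, D) (Suc i) = C * (A ^\<^sub>m i) * B"

definition output_reachable :: "nat \<Rightarrow> nat \<Rightarrow> nat \<Rightarrow> lti \<Rightarrow> bool" where
  "output_reachable n m p S \<longleftrightarrow>
     (\<forall>yh \<in> carrier_vec p. \<exists>T u. (\<forall>k\<le>T. u k \<in> carrier_vec m) \<and> lti_output S (0\<^sub>v n) u T = yh)"

definition output_reachable_systems :: "nat \<Rightarrow> nat \<Rightarrow> nat \<Rightarrow> lti set" where
  "output_reachable_systems n m p = {S \<in> lti_systems n m p. output_reachable n m p S}"

text \<open>Block row l of the Hankel matrix occupies the rows l * q, ..., l * q + q - 1. If N < L, the
  matrix has no columns.\<close>

definition hankel :: "nat \<Rightarrow> nat \<Rightarrow> nat \<Rightarrow> (nat \<Rightarrow> real vec) \<Rightarrow> real mat" where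
  "hankel q L N w = mat (q * L) (N + 1 - L) (\<lambda>(i, k). w (k + i div q) $ (i mod q))"

definition persistently_exciting :: "nat \<Rightarrow> nat \<Rightarrow> nat \<Rightarrow> (nat \<Rightarrow> real vec) \<Rightarrow> bool" where
  "persistently_exciting q L N w \<longleftrightarrow> vec_space.rank (q * L) (hankel q L N w) = q * L"

end

theory Submission
  imports Defs
begin

text \<open>Suppose \<open>z\<close> is orthogonal to all outputs, and put \<open>\<eta>\<^sub>j = \<Gamma>\<^sub>j\<^sup>T z\<close>. A nontrivial relation
  \<open>\<Sum>\<^sub>i b\<^sub>i z\<^sup>T C A\<^sup>i = 0\<close> with \<open>i \<le> n\<close> and \<open>b\<^sub>n \<noteq> 0\<close> (obtained from linear dependence, in place of
  Cayley-Hamilton) eliminates the state from \<open>\<Sum>\<^sub>i b\<^sub>i z\<^sup>T y\<^sub>k\<^sub>+\<^sub>i = 0\<close>. What remains is a relation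
  \<open>\<Sum>\<^sub>l g\<^sub>l\<^sup>T u\<^sub>k\<^sub>+\<^sub>l = 0\<close> with \<open>g\<^sub>l = \<Sum>\<^sub>i b\<^sub>i \<eta>\<^sub>i\<^sub>-\<^sub>l\<close>, and \<open>g\<^sub>l = 0\<close> for \<open>l > n - r\<close> since the first
  \<open>r\<close> Markov parameters vanish. Persistency of excitation of order \<open>n + 1 - r\<close> thus gives \<open>g = 0\<close>, hence
  \<open>\<eta>\<^sub>j = 0\<close> for \<open>j \<le> n\<close>, and for all \<open>j\<close> by the recurrence with coefficients \<open>b\<close>. So \<open>z\<close> is orthogonal to
  every output reachable from the origin, which forces \<open>z = 0\<close>.\<close>

section \<open>Full row rank and vectors orthogonal to all columns\<close>

text \<open>A maximal independent set of columns has \<open>n\<close> elements and is therefore a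
  basis. So \<open>v\<close> is orthogonal to the whole space, in particular to the unit vectors,
  which read off its coordinates.\<close>

lemma (in vec_space) full_row_rank_orthogonal_zero:
  assumes A: "A \<in> carrier_mat n nc" and r: "rank A = n"
    and v: "v \<in> carrier_vec n" and orth: "\<And>j. j < nc \<Longrightarrow> v \<bullet> col A j = 0"
  shows "v = 0\<^sub>v n"
proof -
  have cols: "set (cols A) \<subseteq> carrier_vec n" using A cols_dim by blast
  obtain S where S: "maximal S (\<lambda>T. T \<subseteq> set (cols A) \<and> lin_indpt T)"
    using maximal_exists_superset[of "set (cols A)" "\<lambda>T. T \<subseteq> set (cols A) \<and> lin_indpt T" "{}"]
      finite_lin_indpt2[of "{}"] by auto
  then have SA: "S \<subseteq> set (cols A)" and li: "lin_indpt S" by (auto simp: maximal_def)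
  have card: "card S = n" using rank_card_indpt[OF A S] r by simp
  have "basis S"
    using dim_li_is_basis[of S] SA cols li card dim_is_n finite_subset[OF SA] by auto
  then have "span S = carrier_vec n" by (simp add: basis_def)
  then have sp: "span (set (cols A)) = carrier_vec n"
    using span_is_monotone[OF SA] span_closed[OF cols] by auto
  have "v \<in> orthogonal_complement (set (cols A))"
    using v orth A by (auto simp: orthogonal_complement_def cols_def)
  then have "v \<in> orthogonal_complement (carrier_vec n)"
    using in_orthogonal_complement_span[OF cols] sp by simp
  then have "v \<bullet> unit_vec n i = 0" if "i < n" for i
    by (simp add: orthogonal_complement_def)
  then show ?thesis using v by (intro eq_vecI) auto
qed

text \<open>Padding the coefficients with zero rows gives a singular square matrix, whose kernel
  supplies \<open>v\<close>.\<close>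

lemma fewer_equations_nontrivial_solution:
  fixes f :: "nat \<Rightarrow> nat \<Rightarrow> 'a::field"
  assumes "k < n"
  obtains v where "v \<in> carrier_vec n" "v \<noteq> 0\<^sub>v n"
    "\<And>i. i < k \<Longrightarrow> (\<Sum>j<n. f i j * v $ j) = 0"
proof -
  define M where "M = mat n n (\<lambda>(i, j). if i < k then f i j else 0)"
  have M: "M \<in> carrier_mat n n" by (simp add: M_def)
  \<comment> \<open>Row \<open>k\<close> is one of the padding rows because \<open>k < n\<close>;
    overwriting it by zero changes nothing but brings \<open>M\<close> into the shape of
    \<open>det_row_0\<close>.\<close>
  have "M = mat\<^sub>r n n (\<lambda>i. if i = k then 0\<^sub>v n else row M i)"
    by (rule eq_matI) (auto simp: M_def)
  then have "det M = 0" using det_row_0[OF assms, of "row M"] M by force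
  then obtain v where v: "v \<in> carrier_vec n" "v \<noteq> 0\<^sub>v n" "M *\<^sub>v v = 0\<^sub>v n"
    using det_0_iff_vec_prod_zero_field[OF M] by blast
  have "(\<Sum>j<n. f i j * v $ j) = 0" if "i < k" for i
  proof -
    have "(M *\<^sub>v v) $ i = 0" using v that assms by simp
    then show ?thesis using v that assms
      by (simp add: M_def scalar_prod_def atLeast0LessThan)
  qed
  with v that show ?thesis by blast
qed

text \<open>If the rank were smaller, a maximal independent set \<open>S\<close> of columns would
  have fewer than \<open>n\<close> elements, so some nonzero \<open>v\<close> would be orthogonal to
  \<open>S\<close>. By maximality the span of \<open>S\<close> contains every column, so
  \<open>v\<close> would contradict \<open>orth\<close>.\<close>

lemma (in vec_space) full_row_rank_if_orthogonal_zero: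
  assumes A: "A \<in> carrier_mat n nc"
    and orth: "\<And>v. v \<in> carrier_vec n \<Longrightarrow> (\<And>j. j < nc \<Longrightarrow> v \<bullet> col A j = 0) \<Longrightarrow> v = 0\<^sub>v n"
  shows "rank A = n"
proof (rule ccontr)
  assume neq: "rank A \<noteq> n"
  have cols: "set (cols A) \<subseteq> carrier_vec n" using A cols_dim by blast
  obtain S where S: "maximal S (\<lambda>T. T \<subseteq> set (cols A) \<and> lin_indpt T)"
    using maximal_exists_superset[of "set (cols A)" "\<lambda>T. T \<subseteq> set (cols A) \<and> lin_indpt T" "{}"]
      finite_lin_indpt2[of "{}"] by auto
  then have SA: "S \<subseteq> set (cols A)" and li: "lin_indpt S" by (auto simp: maximal_def)
  have Sc: "S \<subseteq> carrier_vec n" and fin: "finite S" using SA cols finite_subset by auto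
  have "card S \<le> n" using li_le_dim(2)[of S] Sc li dim_is_n by simp
  then have lt: "card S < n" using rank_card_indpt[OF A S] neq by simp
  obtain ss where ss: "set ss = S" "length ss = card S"
    using finite_distinct_list[OF fin] distinct_card by metis
  obtain v where v: "v \<in> carrier_vec n" "v \<noteq> 0\<^sub>v n"
    and vs: "\<And>i. i < card S \<Longrightarrow> (\<Sum>j<n. ss ! i $ j * v $ j) = 0"
    using fewer_equations_nontrivial_solution[OF lt, of "\<lambda>i j. ss ! i $ j"] by metis
  have "v \<bullet> s = 0" if "s \<in> S" for s
  proof -
    obtain i where "i < card S" "s = ss ! i" using \<open>s \<in> S\<close> ss by (metis in_set_conv_nth)
    moreover have "s \<in> carrier_vec n" using that Sc by auto
    ultimately show ?thesis using vs[of i]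
      by (simp add: scalar_prod_def atLeast0LessThan mult.commute)
  qed
  then have "v \<in> orthogonal_complement S" using v by (simp add: orthogonal_complement_def)
  then have *: "v \<in> orthogonal_complement (span S)" using in_orthogonal_complement_span[OF Sc] by simp
  have "c \<in> span S" if c: "c \<in> set (cols A)" for c
  proof (rule ccontr)
    assume ns: "c \<notin> span S"
    then have "c \<notin> S" using span_mem[OF Sc] by blast
    moreover have "lin_indpt (insert c S)"
      using lin_dep_iff_in_span[OF Sc li, of c] ns c cols \<open>c \<notin> S\<close> by auto
    ultimately show False using S SA c unfolding maximal_def by blast
  qed
  then have "v \<bullet> col A j = 0" if "j < nc" for j
    using * that A by (auto simp: orthogonal_complement_def cols_def)
  then show False using orth v by blast
qed

section \<open>Linear relations between powers of a matrix\<close>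

lemma pow_mat_add:
  assumes A: "A \<in> carrier_mat n n"
  shows "A ^\<^sub>m (i + j) = A ^\<^sub>m i * A ^\<^sub>m j"
proof (induction j)
  case (Suc j)
  then show ?case
    using assoc_mult_mat[of "A ^\<^sub>m i" n n "A ^\<^sub>m j" n A n] A by simp
qed (use A in simp)

text \<open>The \<open>n + 1\<close> vectors \<open>W i\<close> lie in dimension \<open>n\<close>,
  hence are dependent. A shift of the indices moves the last nonzero coefficient to position
  \<open>n\<close>; the later triangular system and recurrence both divide by it.\<close>

lemma krylov_relation:
  fixes A :: "real mat"
  assumes A: "A \<in> carrier_mat n n" and w: "w \<in> carrier_vec n"
  obtains b :: "nat \<Rightarrow> real" where "b n \<noteq> 0"
    "\<And>x. x \<in> carrier_vec n \<Longrightarrow> (\<Sum>i\<le>n. b i * (w \<bullet> ((A ^\<^sub>m i) *\<^sub>v x))) = 0"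
proof -
  have Ai [simp]: "A ^\<^sub>m i \<in> carrier_mat n n" for i using A by simp
  define W where "W i = (A ^\<^sub>m i)\<^sup>T *\<^sub>v w" for i
  have Wc: "W i \<in> carrier_vec n" for i
    unfolding W_def by (rule mult_mat_vec_carrier[of _ _ n]) (use w in auto)
  have WA: "w \<bullet> ((A ^\<^sub>m i) *\<^sub>v x) = W i \<bullet> x" if "x \<in> carrier_vec n" for x i
    unfolding W_def using transpose_vec_mult_scalar[OF Ai that w] by simp
  obtain a where a: "a \<in> carrier_vec (Suc n)" "a \<noteq> 0\<^sub>v (Suc n)"
    and rel: "\<And>t. t < n \<Longrightarrow> (\<Sum>i<Suc n. W i $ t * a $ i) = 0"
    using fewer_equations_nontrivial_solution[of n "Suc n" "\<lambda>t i. W i $ t"] by auto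
  have rel': "(\<Sum>i\<le>n. a $ i * (w \<bullet> ((A ^\<^sub>m i) *\<^sub>v x))) = 0" if x: "x \<in> carrier_vec n" for x
  proof -
    have "(\<Sum>i\<le>n. a $ i * (w \<bullet> ((A ^\<^sub>m i) *\<^sub>v x))) = (\<Sum>i\<le>n. \<Sum>t<n. a $ i * (W i $ t * x $ t))"
      using x by (simp only: WA[OF x]) (simp add: scalar_prod_def sum_distrib_left atLeast0LessThan)
    also have "\<dots> = (\<Sum>t<n. (\<Sum>i<Suc n. W i $ t * a $ i) * x $ t)"
      by (subst sum.swap)
        (simp add: sum_distrib_left lessThan_Suc_atMost mult_ac del: sum.lessThan_Suc)
    finally show ?thesis using rel by simp
  qed
  define d where "d = Max {i. i \<le> n \<and> a $ i \<noteq> 0}"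
  have "\<exists>i\<le>n. a $ i \<noteq> 0"
  proof (rule ccontr)
    assume "\<not> ?thesis"
    then have "a = 0\<^sub>v (Suc n)" using a(1) by (intro eq_vecI) auto
    then show False using a(2) by simp
  qed
  then have "d \<in> {i. i \<le> n \<and> a $ i \<noteq> 0}" unfolding d_def by (intro Max_in) auto
  then have d: "d \<le> n" "a $ d \<noteq> 0" by auto
  have dmax: "a $ i = 0" if "d < i" "i \<le> n" for i
    using that Max_ge[of "{i. i \<le> n \<and> a $ i \<noteq> 0}" i] unfolding d_def by fastforce
  \<comment> \<open>In terms of polynomials, the relation \<open>a\<close> of degree
    \<open>d\<close> is multiplied by the power \<open>n - d\<close> of the variable. Evaluating
    \<open>b\<close> at \<open>x\<close> then amounts to evaluating \<open>a\<close> at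
    \<open>?y\<close>.\<close>
  define b where "b i = (if i < n - d then 0 else a $ (i - (n - d)))" for i
  have "b n \<noteq> 0" using d by (simp add: b_def)
  moreover have "(\<Sum>i\<le>n. b i * (w \<bullet> ((A ^\<^sub>m i) *\<^sub>v x))) = 0" if x: "x \<in> carrier_vec n" for x
  proof -
    let ?y = "(A ^\<^sub>m (n - d)) *\<^sub>v x"
    have y: "?y \<in> carrier_vec n" using x by (intro mult_mat_vec_carrier[OF Ai])
    have "(\<Sum>i\<le>n. b i * (w \<bullet> ((A ^\<^sub>m i) *\<^sub>v x)))
        = (\<Sum>i\<in>{n-d..n}. a $ (i - (n - d)) * (w \<bullet> ((A ^\<^sub>m i) *\<^sub>v x)))"
      by (rule sum.mono_neutral_cong_right) (auto simp: b_def)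
    also have "\<dots> = (\<Sum>i\<le>d. a $ i * (w \<bullet> ((A ^\<^sub>m (i + (n - d))) *\<^sub>v x)))"
      by (rule sum.reindex_bij_witness[of _ "\<lambda>i. i + (n - d)" "\<lambda>i. i - (n - d)"]) (use d in auto)
    also have "\<dots> = (\<Sum>i\<le>d. a $ i * (w \<bullet> ((A ^\<^sub>m i) *\<^sub>v ?y)))"
      by (intro sum.cong refl) (simp add: pow_mat_add[OF A] assoc_mult_mat_vec[OF Ai Ai x])
    also have "\<dots> = (\<Sum>i\<le>n. a $ i * (w \<bullet> ((A ^\<^sub>m i) *\<^sub>v ?y)))"
      by (rule sum.mono_neutral_left) (use d dmax in auto)
    finally show ?thesis using rel'[OF y] by simp
  qed
  ultimately show ?thesis using that by blast
qed

section \<open>Trajectories, Markov parameters and output reachability\<close>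

lemma col_hankel_1:
  assumes "k < N" "w k \<in> carrier_vec q"
  shows "col (hankel q 1 N w) k = w k"
  using assms by (intro eq_vecI) (auto simp: hankel_def)

locale lti_system =
  fixes n m p :: nat and A B C D :: "real mat"
  assumes A: "A \<in> carrier_mat n n" and B: "B \<in> carrier_mat n m"
    and C: "C \<in> carrier_mat p n" and D: "D \<in> carrier_mat p m"
begin

abbreviation "S \<equiv> (A, B, C, D)"

lemma A_pow [simp]: "A ^\<^sub>m i \<in> carrier_mat n n"
  using A by simp

lemma markov_carrier: "markov S j \<in> carrier_mat p m"
  using A B C D by (cases j) auto

lemma state_carrier:
  assumes "x0 \<in> carrier_vec n" "\<forall>j<k. u j \<in> carrier_vec m"
  shows "state S x0 u k \<in> carrier_vec n"
  using assms
proof (induction k)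
  case (Suc k)
  then show ?case using A B by (auto intro!: add_carrier_vec mult_mat_vec_carrier)
qed simp

lemma output_carrier:
  assumes "x0 \<in> carrier_vec n" "\<forall>j\<le>k. u j \<in> carrier_vec m"
  shows "lti_output S x0 u k \<in> carrier_vec p"
  using state_carrier[of x0 k u] assms C D by (auto intro!: add_carrier_vec mult_mat_vec_carrier)

text \<open>Variation of constants, started at time \<open>k\<close> and tested against
  \<open>w\<close>. The induction peels off the first time step, so \<open>k\<close> has to be
  arbitrary.\<close>

lemma scalar_state_expansion:
  assumes x0: "x0 \<in> carrier_vec n" and u: "\<forall>j<k+i. u j \<in> carrier_vec m"
    and w: "w \<in> carrier_vec n"
  shows "w \<bullet> state S x0 u (k + i) = w \<bullet> ((A ^\<^sub>m i) *\<^sub>v state S x0 u k)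
           + (\<Sum>l<i. w \<bullet> ((A ^\<^sub>m (i - 1 - l)) *\<^sub>v (B *\<^sub>v u (k + l))))"
  using u
proof (induction i arbitrary: k)
  case 0
  then show ?case using state_carrier[OF x0, of k u] A by simp
next
  case (Suc i)
  let ?x = "state S x0 u k"
  have x: "?x \<in> carrier_vec n" using Suc.prems by (intro state_carrier x0) auto
  have uk: "u k \<in> carrier_vec m" using Suc.prems by auto
  have Bu: "B *\<^sub>v u k \<in> carrier_vec n" and Ax: "A *\<^sub>v ?x \<in> carrier_vec n"
    using A B uk x by (auto intro: mult_mat_vec_carrier)
  have c: "(A ^\<^sub>m i) *\<^sub>v (A *\<^sub>v ?x) \<in> carrier_vec n" "(A ^\<^sub>m i) *\<^sub>v (B *\<^sub>v u k) \<in> carrier_vec n"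
    using Bu Ax by (auto intro: mult_mat_vec_carrier[OF A_pow])
  \<comment> \<open>The hypothesis is used from time \<open>Suc k\<close>; the input
    \<open>u k\<close> entering that state becomes the term \<open>l = 0\<close>.\<close>
  have "w \<bullet> state S x0 u (Suc k + i) = w \<bullet> ((A ^\<^sub>m i) *\<^sub>v state S x0 u (Suc k))
           + (\<Sum>l<i. w \<bullet> ((A ^\<^sub>m (i - 1 - l)) *\<^sub>v (B *\<^sub>v u (Suc k + l))))"
    using Suc.prems by (intro Suc.IH) auto
  moreover have "w \<bullet> ((A ^\<^sub>m i) *\<^sub>v state S x0 u (Suc k))
      = w \<bullet> ((A ^\<^sub>m Suc i) *\<^sub>v ?x) + w \<bullet> ((A ^\<^sub>m i) *\<^sub>v (B *\<^sub>v u k))"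
    using assoc_mult_mat_vec[OF A_pow A x] c
    by (simp add: mult_add_distrib_mat_vec[OF A_pow Ax Bu] scalar_prod_add_distrib[OF w])
  ultimately show ?case
    by (simp only: sum.lessThan_Suc_shift) simp
qed

text \<open>Moving \<open>C\<close> across the scalar product turns the convolution terms of the
  state into Markov parameters; the feedthrough \<open>D\<close> supplies the term
  \<open>l = i\<close>.\<close>

lemma scalar_output_expansion:
  assumes x0: "x0 \<in> carrier_vec n" and u: "\<forall>j\<le>k+i. u j \<in> carrier_vec m"
    and z: "z \<in> carrier_vec p"
  shows "z \<bullet> lti_output S x0 u (k + i) = (C\<^sup>T *\<^sub>v z) \<bullet> ((A ^\<^sub>m i) *\<^sub>v state S x0 u k)
           + (\<Sum>l\<le>i. ((markov S (i - l))\<^sup>T *\<^sub>v z) \<bullet> u (k + l))"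
proof -
  have w: "C\<^sup>T *\<^sub>v z \<in> carrier_vec n" using C z by (auto intro: mult_mat_vec_carrier)
  have x: "state S x0 u (k + i) \<in> carrier_vec n" using u by (intro state_carrier x0) auto
  have "z \<bullet> lti_output S x0 u (k + i) = z \<bullet> (C *\<^sub>v state S x0 u (k + i)) + z \<bullet> (D *\<^sub>v u (k + i))"
    using C D x u z by (auto intro!: scalar_prod_add_distrib mult_mat_vec_carrier)
  moreover have "z \<bullet> (C *\<^sub>v state S x0 u (k + i)) = (C\<^sup>T *\<^sub>v z) \<bullet> state S x0 u (k + i)"
    using transpose_vec_mult_scalar[OF C x z] by simp
  moreover have "z \<bullet> (D *\<^sub>v u (k + i)) = (D\<^sup>T *\<^sub>v z) \<bullet> u (k + i)"
    using transpose_vec_mult_scalar[OF D _ z, of "u (k + i)"] u by simp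
  moreover have "(C\<^sup>T *\<^sub>v z) \<bullet> ((A ^\<^sub>m (i - 1 - l)) *\<^sub>v (B *\<^sub>v u (k + l)))
      = ((markov S (i - l))\<^sup>T *\<^sub>v z) \<bullet> u (k + l)" if l: "l < i" for l
  proof -
    obtain j where j: "i - l = Suc j" "i - 1 - l = j"
      using l by (metis Suc_diff_Suc diff_Suc_eq_diff_pred diff_commute)
    have ul: "u (k + l) \<in> carrier_vec m" using u l by auto
    have Bu: "B *\<^sub>v u (k + l) \<in> carrier_vec n" using B ul by (auto intro: mult_mat_vec_carrier)
    have "(C\<^sup>T *\<^sub>v z) \<bullet> ((A ^\<^sub>m j) *\<^sub>v (B *\<^sub>v u (k + l))) = z \<bullet> (C *\<^sub>v ((A ^\<^sub>m j) *\<^sub>v (B *\<^sub>v u (k + l))))"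
      by (rule transpose_vec_mult_scalar[OF C _ z]) (rule mult_mat_vec_carrier[OF A_pow Bu])
    also have "C *\<^sub>v ((A ^\<^sub>m j) *\<^sub>v (B *\<^sub>v u (k + l))) = markov S (Suc j) *\<^sub>v u (k + l)"
      using assoc_mult_mat_vec[OF C A_pow[of j] Bu]
        assoc_mult_mat_vec[OF mult_carrier_mat[OF C A_pow[of j]] B ul] by simp
    also have "z \<bullet> \<dots> = ((markov S (Suc j))\<^sup>T *\<^sub>v z) \<bullet> u (k + l)"
      by (rule transpose_vec_mult_scalar[OF markov_carrier ul z, symmetric])
    finally show ?thesis using j by simp
  qed
  moreover have "\<forall>j<k+i. u j \<in> carrier_vec m" using u by auto
  ultimately show ?thesis
    using scalar_state_expansion[OF x0 _ w, of k i u]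
    by (simp add: lessThan_Suc_atMost[symmetric])
qed

text \<open>This is \<open>rel\<close> at the vector \<open>?y\<close>. It only involves Markov
  parameters of positive index, since \<open>D\<close> is not of the form
  \<open>C * A ^\<^sub>m i * B\<close>.\<close>

lemma markov_functional_recurrence:
  assumes z: "z \<in> carrier_vec p"
    and rel: "\<And>x. x \<in> carrier_vec n \<Longrightarrow> (\<Sum>i\<le>n. b i * ((C\<^sup>T *\<^sub>v z) \<bullet> ((A ^\<^sub>m i) *\<^sub>v x))) = 0"
    and v: "v \<in> carrier_vec m"
  shows "(\<Sum>i\<le>n. b i * (((markov S (Suc (i + q)))\<^sup>T *\<^sub>v z) \<bullet> v)) = 0"
proof -
  have Bv: "B *\<^sub>v v \<in> carrier_vec n" using B v by (auto intro: mult_mat_vec_carrier)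
  let ?y = "(A ^\<^sub>m q) *\<^sub>v (B *\<^sub>v v)"
  have y: "?y \<in> carrier_vec n" using Bv by (rule mult_mat_vec_carrier[OF A_pow])
  have "((markov S (Suc (i + q)))\<^sup>T *\<^sub>v z) \<bullet> v = (C\<^sup>T *\<^sub>v z) \<bullet> ((A ^\<^sub>m i) *\<^sub>v ?y)" for i
  proof -
    have "((markov S (Suc (i + q)))\<^sup>T *\<^sub>v z) \<bullet> v = z \<bullet> (markov S (Suc (i + q)) *\<^sub>v v)"
      by (rule transpose_vec_mult_scalar[OF markov_carrier v z])
    also have "markov S (Suc (i + q)) *\<^sub>v v = C *\<^sub>v ((A ^\<^sub>m (i + q)) *\<^sub>v (B *\<^sub>v v))"
      using assoc_mult_mat_vec[OF C A_pow[of "i + q"] Bv]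
        assoc_mult_mat_vec[OF mult_carrier_mat[OF C A_pow[of "i + q"]] B v] by simp
    also have "(A ^\<^sub>m (i + q)) *\<^sub>v (B *\<^sub>v v) = (A ^\<^sub>m i) *\<^sub>v ?y"
      by (simp only: pow_mat_add[OF A] assoc_mult_mat_vec[OF A_pow A_pow Bv])
    also have "z \<bullet> (C *\<^sub>v \<dots>) = (C\<^sup>T *\<^sub>v z) \<bullet> \<dots>"
      by (rule transpose_vec_mult_scalar[OF C _ z, symmetric]) (rule mult_mat_vec_carrier[OF A_pow y])
    finally show ?thesis .
  qed
  then show ?thesis using rel[OF y] by simp
qed

text \<open>From the zero state, the output expansion at \<open>k = 0\<close> consists of Markov
  terms alone. So \<open>z\<close> is orthogonal to each reachable output, and every unit vector is
  reachable.\<close>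

lemma output_reachable_orthogonal_zero:
  assumes reach: "output_reachable n m p S" and z: "z \<in> carrier_vec p"
    and mk: "\<And>j. (markov S j)\<^sup>T *\<^sub>v z = 0\<^sub>v m"
  shows "z = 0\<^sub>v p"
proof (rule eq_vecI)
  fix t assume "t < dim_vec (0\<^sub>v p :: real vec)"
  then have t: "t < p" by simp
  then obtain T u where u: "\<forall>k\<le>T. u k \<in> carrier_vec m"
    and out: "lti_output S (0\<^sub>v n) u T = unit_vec p t"
    using reach unit_vec_carrier unfolding output_reachable_def by blast
  have w: "C\<^sup>T *\<^sub>v z \<in> carrier_vec n" using C z by (auto intro: mult_mat_vec_carrier)
  have "(A ^\<^sub>m T) *\<^sub>v 0\<^sub>v n = 0\<^sub>v n"
    using carrier_matD[OF A_pow[of T]] by (intro eq_vecI) (simp_all del: pow_mat_dim pow_mat_dim_square)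
  then have "z \<bullet> unit_vec p t = (\<Sum>l\<le>T. (0\<^sub>v m) \<bullet> u l)"
    using scalar_output_expansion[of "0\<^sub>v n" 0 T u z] u z out mk w by simp
  then show "z $ t = (0\<^sub>v p) $ t" using u z t by simp
qed (use z in simp)

section \<open>Transfer of excitation from input to output\<close>

theorem output_persistently_exciting:
  assumes r: "r \<le> n" and u: "\<forall>k<N. u k \<in> carrier_vec m"
    and pe: "persistently_exciting m (n + 1 - r) (N - r) u"
    and reach: "output_reachable n m p S" and mk0: "\<forall>i<r. markov S i = 0\<^sub>m p m"
    and x0: "x0 \<in> carrier_vec n"
  shows "persistently_exciting p 1 N (lti_output S x0 u)"
proof -
  let ?y = "lti_output S x0 u"
  \<comment> \<open>The columns of the order-one Hankel matrix are the outputs, so this is the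
    orthogonality criterion for rank \<open>p\<close>.\<close>
  have "z = 0\<^sub>v p" if z: "z \<in> carrier_vec p" and orth: "\<And>k. k < N \<Longrightarrow> z \<bullet> ?y k = 0" for z
  proof -
    define L where "L = n + 1 - r"
    define \<eta> where "\<eta> j = (markov S j)\<^sup>T *\<^sub>v z" for j
    have \<eta>c: "\<eta> j \<in> carrier_vec m" for j
      unfolding \<eta>_def using markov_carrier[of j] z by (auto intro: mult_mat_vec_carrier)
    have \<eta>0: "\<eta> j = 0\<^sub>v m" if "j < r" for j
      using mk0 that z unfolding \<eta>_def by (intro eq_vecI) auto
    have w: "C\<^sup>T *\<^sub>v z \<in> carrier_vec n" using C z by (auto intro: mult_mat_vec_carrier)
    obtain b :: "nat \<Rightarrow> real" where bn: "b n \<noteq> 0" and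
      b: "\<And>x. x \<in> carrier_vec n \<Longrightarrow> (\<Sum>i\<le>n. b i * ((C\<^sup>T *\<^sub>v z) \<bullet> ((A ^\<^sub>m i) *\<^sub>v x))) = 0"
      using krylov_relation[OF A w] by blast
    \<comment> \<open>\<open>g l\<close> collects the coefficients of \<open>u (k + l)\<close>; the
      sum starts at \<open>l\<close> because earlier outputs do not depend on that input.\<close>
    define g where "g l = vec m (\<lambda>t. \<Sum>i\<in>{l..n}. b i * \<eta> (i - l) $ t)" for l
    \<comment> \<open>Here \<open>i - l \<le> n - l < r\<close> for every summand, and the sum is
      empty when \<open>l > n\<close>.\<close>
    have g_high: "g l = 0\<^sub>v m" if "L \<le> l" for l
      using that r by (intro eq_vecI) (auto simp: g_def L_def \<eta>0 intro!: sum.neutral)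
    \<comment> \<open>The bound on \<open>k\<close> keeps all outputs up to index
      \<open>k + n\<close> inside the horizon \<open>N\<close>.\<close>
    have g_orth: "(\<Sum>l<L. g l \<bullet> u (k + l)) = 0" if k: "k < N - n" for k
    proof -
      have uk: "u (k + i) \<in> carrier_vec m" if "i \<le> n" for i using u k that by auto
      have exp: "z \<bullet> ?y (k + i) = (C\<^sup>T *\<^sub>v z) \<bullet> ((A ^\<^sub>m i) *\<^sub>v state S x0 u k)
           + (\<Sum>l\<le>i. \<eta> (i - l) \<bullet> u (k + l))" if "i \<le> n" for i
        unfolding \<eta>_def using u k that by (intro scalar_output_expansion x0 z) auto
      have x: "state S x0 u k \<in> carrier_vec n" using u k by (intro state_carrier x0) auto
      have gu: "g l \<bullet> u (k + l) = (\<Sum>i\<in>{l..n}. b i * (\<eta> (i - l) \<bullet> u (k + l)))" if "l \<le> n" for l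
        using uk[OF that]
        by (simp add: g_def scalar_prod_def sum_distrib_right sum_distrib_left mult.assoc)
          (rule sum.swap)
      have "0 = (\<Sum>i\<le>n. b i * (z \<bullet> ?y (k + i)))"
        using orth k by (intro sum.neutral[symmetric]) auto
      also have "\<dots> = (\<Sum>i\<le>n. b i * (\<Sum>l\<le>i. \<eta> (i - l) \<bullet> u (k + l)))"
        using b[OF x] by (simp add: exp distrib_left sum.distrib del: lti_output.simps)
      also have "\<dots> = (\<Sum>i\<le>n. \<Sum>l\<le>i. b i * (\<eta> (i - l) \<bullet> u (k + l)))"
        by (simp add: sum_distrib_left)
      also have "\<dots> = (\<Sum>l\<le>n. \<Sum>i\<in>{l..n}. b i * (\<eta> (i - l) \<bullet> u (k + l)))"
        by (simp add: sum.Sigma)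
          (rule sum.reindex_bij_witness[of _ "\<lambda>(x, y). (y, x)" "\<lambda>(x, y). (y, x)"], auto)
      also have "\<dots> = (\<Sum>l\<le>n. g l \<bullet> u (k + l))" by (simp add: gu)
      also have "\<dots> = (\<Sum>l<L. g l \<bullet> u (k + l))"
        by (rule sum.mono_neutral_right) (use uk in \<open>auto simp: L_def g_high\<close>)
      finally show ?thesis by simp
    qed
    \<comment> \<open>\<open>V\<close> stacks \<open>g 0\<close> to \<open>g (L - 1)\<close> in the
      row order of the Hankel matrix, so that its product with column \<open>k\<close> is the sum in
      \<open>g_orth\<close>.\<close>
    define V where "V = vec (m * L) (\<lambda>i. g (i div m) $ (i mod m))"
    have Vc: "V \<in> carrier_vec (m * L)" by (simp add: V_def)
    \<comment> \<open>The truncation to length \<open>N - r\<close> gives exactly the columns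
      \<open>k < N - n\<close> for which \<open>g_orth\<close> is available.\<close>
    have cols: "N - r + 1 - L = N - n" using r by (simp add: L_def)
    have H: "hankel m L (N - r) u = mat (m * L) (N - n) (\<lambda>(i, k). u (k + i div m) $ (i mod m))"
      unfolding hankel_def cols ..
    have Hc: "hankel m L (N - r) u \<in> carrier_mat (m * L) (N - n)"
      by (simp add: H)
    have "V \<bullet> col (hankel m L (N - r) u) k = 0" if k: "k < N - n" for k
    proof -
      have "V \<bullet> col (hankel m L (N - r) u) k
          = (\<Sum>i<L * m. g (i div m) $ (i mod m) * u (k + i div m) $ (i mod m))"
        using k by (simp add: V_def H scalar_prod_def atLeast0LessThan mult.commute)
      also have "\<dots> = (\<Sum>l<L. \<Sum>i=l*m..<l*m+m. g (i div m) $ (i mod m) * u (k + i div m) $ (i mod m))"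
        by (rule sum.nat_group[symmetric])
      also have "\<dots> = (\<Sum>l<L. g l \<bullet> u (k + l))"
      proof (rule sum.cong[OF refl])
        fix l assume "l \<in> {..<L}"
        then have ul: "u (k + l) \<in> carrier_vec m" using u k r by (auto simp: L_def)
        have div: "i div m = l" if "l * m \<le> i" "i < l * m + m" for i
          using that by (intro div_nat_eqI) (auto simp: mult.commute)
        then have mod: "i mod m = i - l * m" if "l * m \<le> i" "i < l * m + m" for i
          using that by (metis minus_div_mult_eq_mod)
        have "(\<Sum>i=l*m..<l*m+m. g (i div m) $ (i mod m) * u (k + i div m) $ (i mod m))
            = (\<Sum>t=0..<m. g l $ t * u (k + l) $ t)"
          by (rule sum.reindex_bij_witness[of _ "\<lambda>t. l * m + t" "\<lambda>i. i - l * m"])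
            (auto simp: div mod)
        then show "(\<Sum>i=l*m..<l*m+m. g (i div m) $ (i mod m) * u (k + i div m) $ (i mod m))
            = g l \<bullet> u (k + l)" using ul by (simp add: scalar_prod_def)
      qed
      finally show ?thesis using g_orth[OF k] by simp
    qed
    then have V0: "V = 0\<^sub>v (m * L)"
      using vec_space.full_row_rank_orthogonal_zero[OF Hc _ Vc] pe
      by (simp add: persistently_exciting_def L_def)
    have g_low: "g l = 0\<^sub>v m" if "l < L" for l
    proof (rule eq_vecI)
      fix t assume "t < dim_vec (0\<^sub>v m :: real vec)"
      then have t: "t < m" by simp
      have "l * m + t < Suc l * m" using t by simp
      also have "\<dots> \<le> L * m" using that by (intro mult_right_mono) auto
      finally have lt: "l * m + t < m * L" by (simp add: mult.commute)
      have "V $ (l * m + t) = g l $ t" using lt t by (simp add: V_def)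
      then show "g l $ t = 0\<^sub>v m $ t" using V0 lt t by simp
    qed (simp add: g_def)
    have g0: "g l = 0\<^sub>v m" for l using g_low g_high by (cases "l < L") auto
    \<comment> \<open>Since \<open>b n \<noteq> 0\<close>, the \<open>g (n - j)\<close> form a triangular system in the \<open>\<eta> j\<close>.\<close>
    have \<eta>_init: "\<eta> j = 0\<^sub>v m" if "j \<le> n" for j
      using that
    proof (induction j rule: less_induct)
      case (less j)
      show ?case
      proof (rule eq_vecI)
        fix t assume "t < dim_vec (0\<^sub>v m :: real vec)"
        then have t: "t < m" by simp
        have "0 = (\<Sum>i\<in>{n-j..n}. b i * \<eta> (i - (n - j)) $ t)"
          using arg_cong[OF g0[of "n - j"], of "\<lambda>v. v $ t"] t by (simp add: g_def)
        also have "\<dots> = (\<Sum>i\<in>{n}. b i * \<eta> (i - (n - j)) $ t)"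
          by (rule sum.mono_neutral_right) (use less t in auto)
        finally show "\<eta> j $ t = 0\<^sub>v m $ t" using bn t less.prems by simp
      qed (use \<eta>c in auto)
    qed
    have "\<eta> j = 0\<^sub>v m" for j
    proof (induction j rule: less_induct)
      case (less j)
      show ?case
      proof (cases "j \<le> n")
        case False
        \<comment> \<open>The recurrence at \<open>q\<close> involves the indices
          \<open>q + 1\<close> to \<open>q + n + 1 = j\<close>. All but the last vanish by
          induction, and the last has the coefficient \<open>b n\<close>.\<close>
        define q where "q = j - Suc n"
        have j: "j = Suc (n + q)" using False by (simp add: q_def)
        show ?thesis
        proof (rule eq_vecI)
          fix t assume "t < dim_vec (0\<^sub>v m :: real vec)"
          then have t: "t < m" by simp
          have "0 = (\<Sum>i\<le>n. b i * (\<eta> (Suc (i + q)) \<bullet> unit_vec m t))"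
            using markov_functional_recurrence[OF z b, of "unit_vec m t" q] by (simp add: \<eta>_def)
          also have "\<dots> = (\<Sum>i\<in>{n}. b i * (\<eta> (Suc (i + q)) \<bullet> unit_vec m t))"
            by (rule sum.mono_neutral_right) (use less j t in auto)
          finally show "\<eta> j $ t = 0\<^sub>v m $ t" using bn t j \<eta>c[of j] by simp
        qed (use \<eta>c in auto)
      qed (rule \<eta>_init)
    qed
    then show ?thesis using output_reachable_orthogonal_zero[OF reach z] by (simp add: \<eta>_def)
  qed
  moreover have "hankel p 1 N ?y \<in> carrier_mat (p * 1) N" by (simp add: hankel_def)
  moreover have "col (hankel p 1 N ?y) k = ?y k" if "k < N" for k
    using output_carrier[OF x0, of k u] u that by (intro col_hankel_1) auto
  ultimately show ?thesis
    unfolding persistently_exciting_def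
    by (intro vec_space.full_row_rank_if_orthogonal_zero[of _ _ N]) simp_all
qed

end

theorem mainTheorem3:
  fixes n m p r N :: nat
    and u :: "nat \<Rightarrow> real vec"
  assumes "r \<le> n"
    and "\<forall>k<N. u k \<in> carrier_vec m"
    and "persistently_exciting m (n + 1 - r) (N - r) u"
  shows "\<forall>S \<in> output_reachable_systems n m p.
           (\<forall>i<r. markov S i = 0\<^sub>m p m) \<and> markov S r \<noteq> 0\<^sub>m p m \<longrightarrow>
           (\<forall>x0 \<in> carrier_vec n. persistently_exciting p 1 N (lti_output S x0 u))"
proof (intro ballI impI)
  fix S and x0 :: "real vec"
  assume S: "S \<in> output_reachable_systems n m p"
    and mk: "(\<forall>i<r. markov S i = 0\<^sub>m p m) \<and> markov S r \<noteq> 0\<^sub>m p m"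
    and x0: "x0 \<in> carrier_vec n"
  obtain A B C D where ABCD: "S = (A, B, C, D)" by (cases S) auto
  interpret lti_system n m p A B C D
    using S ABCD by unfold_locales (auto simp: output_reachable_systems_def lti_systems_def)
  show "persistently_exciting p 1 N (lti_output S x0 u)"
    using output_persistently_exciting[OF assms _ _ x0] S mk ABCD
    by (simp add: output_reachable_systems_def)
qed

end
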